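(* Let $X$ be a completely regular Hausdorff space. The following statements are equivalent: (a) $C_b(X)$ is order complete. (b) $C_b(X)$ has the projection property. (c) $X$ is extremally disconnected.
   Context: $C_b(X)$ is the Banach lattice of bounded continuous real-valued functions on $X$ with the supremum norm and pointwise order. A vector lattice is order complete if every nonempty subset bounded above has a supremum. An order ideal in a vector lattice $E$ is a linear subspace $Y$ such that $0\le |x|\le |y|$ with $x\in E$, $y\in Y$ implies $x\in Y$. A band $B$ in $E$ is an order ideal such that whenever $(x_\alpha)$ is a net in $B$ with $0\le x_\alpha\nearrow x$ in $E$ (increasing with supremum $x$ in $E$), then $x\in B$. With $B^d=\{x\in E: |x|\wedge |b|=0\text{ for all } b\in B\}$, a band $B$ is a projection band if $E=B\oplus B^d$. $E$ has the projection property if every band in $E$ is a projection band. A topological space is extremally disconnected if the closure of every open set is open. *)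

theory Defs
  imports "HOL-Analysis.Analysis" "HOL-Library.Function_Algebras"
begin

instantiation "fun" :: (type, real_vector) real_vector
begin

definition scaleR_fun :: "real \<Rightarrow> ('a \<Rightarrow> 'b) \<Rightarrow> 'a \<Rightarrow> 'b"
  where "scaleR_fun c f = (\<lambda>x. c *\<^sub>R f x)"

instance
  by standard (auto simp: scaleR_fun_def plus_fun_def fun_eq_iff algebra_simps)

end

instance "fun" :: (type, ordered_real_vector) ordered_real_vector
  by standard (auto simp: scaleR_fun_def le_fun_def scaleR_left_mono scaleR_right_mono)

text \<open>
  Vector lattices are represented by a carrier \<open>E\<close> that is a linear subspace of an ambient
  type and is closed under the ambient lattice operations; the modulus and binary meets in
  \<open>E\<close> are then those of the ambient type. Suprema of arbitrary sets need not be, so they are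
  always taken relative to \<open>E\<close>.
\<close>

definition vector_lattice :: "'e::{ordered_real_vector,lattice} set \<Rightarrow> bool"
  where "vector_lattice E \<longleftrightarrow>
    subspace E \<and> (\<forall>x\<in>E. \<forall>y\<in>E. sup x y \<in> E \<and> inf x y \<in> E)"

definition modulus :: "'e::{ordered_real_vector,lattice} \<Rightarrow> 'e"
  where "modulus x = sup x (- x)"

definition is_supremum :: "'e::order set \<Rightarrow> 'e set \<Rightarrow> 'e \<Rightarrow> bool"
  where "is_supremum E A s \<longleftrightarrow>
    s \<in> E \<and> (\<forall>a\<in>A. a \<le> s) \<and> (\<forall>u\<in>E. (\<forall>a\<in>A. a \<le> u) \<longrightarrow> s \<le> u)"

definition order_complete :: "'e::{ordered_real_vector,lattice} set \<Rightarrow> bool"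
  where "order_complete E \<longleftrightarrow>
    (\<forall>A. A \<subseteq> E \<and> A \<noteq> {} \<and> (\<exists>u\<in>E. \<forall>a\<in>A. a \<le> u) \<longrightarrow> (\<exists>s. is_supremum E A s))"

definition order_ideal :: "'e::{ordered_real_vector,lattice} set \<Rightarrow> 'e set \<Rightarrow> bool"
  where "order_ideal E Y \<longleftrightarrow>
    Y \<subseteq> E \<and> subspace Y \<and>
    (\<forall>x\<in>E. \<forall>y\<in>Y. 0 \<le> modulus x \<and> modulus x \<le> modulus y \<longrightarrow> x \<in> Y)"

definition directed_by :: "'i set \<Rightarrow> ('i \<times> 'i) set \<Rightarrow> bool"
  where "directed_by I r \<longleftrightarrow>
    I \<noteq> {} \<and> (\<forall>i\<in>I. (i, i) \<in> r) \<and>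
    (\<forall>i\<in>I. \<forall>j\<in>I. \<forall>k\<in>I. (i, j) \<in> r \<and> (j, k) \<in> r \<longrightarrow> (i, k) \<in> r) \<and>
    (\<forall>i\<in>I. \<forall>j\<in>I. \<exists>k\<in>I. (i, k) \<in> r \<and> (j, k) \<in> r)"

definition net_increases_to ::
    "'e::order set \<Rightarrow> 'i set \<Rightarrow> ('i \<times> 'i) set \<Rightarrow> ('i \<Rightarrow> 'e) \<Rightarrow> 'e \<Rightarrow> bool"
  where "net_increases_to E I r x s \<longleftrightarrow>
    directed_by I r \<and> (\<forall>i\<in>I. \<forall>j\<in>I. (i, j) \<in> r \<longrightarrow> x i \<le> x j) \<and> is_supremum E (x ` I) s"

text \<open>
  A definition cannot quantify over index types, so the nets below are indexed by subsets of the
  ambient type; \<open>band_closed_under_nets\<close> shows that this covers all index types.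
\<close>

definition band :: "'e::{ordered_real_vector,lattice} set \<Rightarrow> 'e set \<Rightarrow> bool"
  where "band E B \<longleftrightarrow>
    order_ideal E B \<and>
    (\<forall>(I :: 'e set) r x s.
      net_increases_to E I r x s \<and> (\<forall>i\<in>I. x i \<in> B \<and> 0 \<le> x i) \<longrightarrow> s \<in> B)"

lemma band_closed_under_nets:
  fixes I :: "'i set" and E :: "'e::{ordered_real_vector,lattice} set"
  assumes "band E B" and net: "net_increases_to E I r x s"
    and mem: "\<And>i. i \<in> I \<Longrightarrow> x i \<in> B \<and> 0 \<le> x i"
  shows "s \<in> B"
proof -
  let ?r = "{(a, b). a \<le> b} :: ('e \<times> 'e) set"
  have "\<exists>c\<in>x ` I. a \<le> c \<and> b \<le> c" if "a \<in> x ` I" "b \<in> x ` I" for a b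
    using that net unfolding net_increases_to_def directed_by_def by blast
  moreover have "x ` I \<noteq> {}" "is_supremum E (x ` I) s"
    using net by (auto simp: net_increases_to_def directed_by_def)
  ultimately have "net_increases_to E (x ` I) ?r (\<lambda>a. a) s"
    unfolding net_increases_to_def directed_by_def by auto
  moreover have "\<forall>a\<in>x ` I. a \<in> B \<and> 0 \<le> a"
    using mem by blast
  ultimately show ?thesis
    using \<open>band E B\<close> unfolding band_def by blast
qed

definition disjoint_complement ::
    "'e::{ordered_real_vector,lattice} set \<Rightarrow> 'e set \<Rightarrow> 'e set"
  where "disjoint_complement E B = {x \<in> E. \<forall>b\<in>B. inf (modulus x) (modulus b) = 0}"

definition direct_sum :: "'e::real_vector set \<Rightarrow> 'e set \<Rightarrow> 'e set \<Rightarrow> bool"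
  where "direct_sum E U V \<longleftrightarrow>
    subspace U \<and> subspace V \<and> E = {u + v | u v. u \<in> U \<and> v \<in> V} \<and> U \<inter> V = {0}"

definition projection_band :: "'e::{ordered_real_vector,lattice} set \<Rightarrow> 'e set \<Rightarrow> bool"
  where "projection_band E B \<longleftrightarrow> band E B \<and> direct_sum E B (disjoint_complement E B)"

definition projection_property :: "'e::{ordered_real_vector,lattice} set \<Rightarrow> bool"
  where "projection_property E \<longleftrightarrow> (\<forall>B. band E B \<longrightarrow> projection_band E B)"

text \<open>
  Functions on the space \<open>X\<close> are represented by total functions on the underlying type that are
  \<open>0\<close> off \<open>topspace X\<close>, so that equality and the pointwise order of the function type are
  equality and pointwise order on \<open>X\<close>.
\<close>

definition C_b :: "'a topology \<Rightarrow> ('a \<Rightarrow> real) set"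
  where "C_b X =
    {f. continuous_map X euclideanreal f \<and> bounded (f ` topspace X) \<and>
        (\<forall>x. x \<notin> topspace X \<longrightarrow> f x = 0)}"

lemma vector_lattice_C_b: "vector_lattice (C_b X)"
proof -
  have bdd: "bounded (f ` S) \<longleftrightarrow> (\<exists>a. \<forall>x\<in>S. \<bar>f x\<bar> \<le> a)" for f :: "'a \<Rightarrow> real" and S
    by (simp add: bounded_iff)
  have "f + g \<in> C_b X" if f: "f \<in> C_b X" and g: "g \<in> C_b X" for f g
    using that bounded_plus_comp[of f "topspace X" g]
    by (auto simp: C_b_def plus_fun_def intro: continuous_map_add)
  moreover have "c *\<^sub>R f \<in> C_b X" if "f \<in> C_b X" for c f
    using that bounded_scaleR_comp[of f "topspace X" c]
    by (auto simp: C_b_def scaleR_fun_def intro: continuous_map_real_mult)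
  moreover have "sup f g \<in> C_b X \<and> inf f g \<in> C_b X"
    if f: "f \<in> C_b X" and g: "g \<in> C_b X" for f g
  proof -
    obtain a b where a: "\<forall>x\<in>topspace X. \<bar>f x\<bar> \<le> a" and b: "\<forall>x\<in>topspace X. \<bar>g x\<bar> \<le> b"
      using f g by (auto simp: C_b_def bdd)
    have "\<forall>x\<in>topspace X. \<bar>max (f x) (g x)\<bar> \<le> max a b"
         "\<forall>x\<in>topspace X. \<bar>min (f x) (g x)\<bar> \<le> max a b"
      using a b by (fastforce simp: max_def min_def)+
    with f g show ?thesis
      unfolding C_b_def bdd
      by (auto simp: sup_fun_def inf_fun_def sup_max inf_min
          intro: continuous_map_real_max continuous_map_real_min)
  qed
  moreover have "0 \<in> C_b X"
    by (auto simp: C_b_def zero_fun_def bdd)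
  ultimately show ?thesis
    by (auto simp: vector_lattice_def subspace_def)
qed

definition extremally_disconnected :: "'a topology \<Rightarrow> bool"
  where "extremally_disconnected X \<longleftrightarrow> (\<forall>U. openin X U \<longrightarrow> openin X (X closure_of U))"

end

(*
  (a) implies (b): in an order complete vector lattice E the component of x \<ge> 0 in a band B is the
  supremum s of {b \<in> B. 0 \<le> b \<le> x}. If b \<in> B, then w = inf (x - s) |b| lies in B, and adding w to
  any member of that set gives another member, which forces w \<le> 0.

  (b) implies (c): for U open put V = X - cl U. The functions vanishing on V form a band, and if
  u is the component of the constant 1 in it, then bump functions show that u = 1 on cl U and
  u = 0 on V. So cl U = {u > 1/2} is open.

  (c) implies (a): if A is bounded above, let U t be the open set where some a \<in> A exceeds t. The
  sets cl (U t) are clopen and decrease in t, and x \<mapsto> Sup {t. x \<in> cl (U t)} is the supremum of A.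
*)

theory Submission
  imports Defs
begin

section \<open>Vector lattices\<close>

lemma modulus_nonneg: "0 \<le> modulus (x :: 'e::{ordered_real_vector,lattice})"
proof -
  \<comment> \<open>Both \<open>x\<close> and \<open>- x\<close> lie below the modulus, so 0 is at
    most twice the modulus; scaling by 1/2 removes the factor.\<close>
  have "x + - x \<le> modulus x + modulus x"
    unfolding modulus_def by (intro add_mono) auto
  then have "0 \<le> (1/2) *\<^sub>R (modulus x + modulus x)"
    by (intro scaleR_nonneg_nonneg) auto
  then show ?thesis
    by (simp flip: scaleR_2)
qed

lemma modulus_of_nonneg:
  fixes x :: "'e::{ordered_real_vector,lattice}"
  assumes "0 \<le> x" shows "modulus x = x"
proof -
  have "- x \<le> x"
    using assms by (meson neg_le_0_iff_le order_trans)
  then show ?thesis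
    by (simp add: modulus_def sup_absorb1)
qed

lemma modulus_eq_0_iff: "modulus x = 0 \<longleftrightarrow> x = (0 :: 'e::{ordered_real_vector,lattice})"
proof
  assume "modulus x = 0"
  then have "x \<le> 0" "- x \<le> 0"
    unfolding modulus_def by (metis sup_ge1, metis sup_ge2)
  then show "x = 0"
    by (intro antisym) simp_all
qed (simp add: modulus_of_nonneg)

lemma modulus_triangle:
  "modulus (x + y) \<le> modulus x + modulus (y :: 'e::{ordered_real_vector,lattice})"
proof -
  have "- x + - y \<le> modulus x + modulus y" "x + y \<le> modulus x + modulus y"
    by (intro add_mono; simp add: modulus_def)+
  then show ?thesis
    by (simp add: modulus_def[of "x + y"] add.commute)
qed

lemma modulus_scaleR_le:
  fixes x :: "'e::{ordered_real_vector,lattice}"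
  shows "modulus (c *\<^sub>R x) \<le> \<bar>c\<bar> *\<^sub>R modulus x"
proof -
  have *: "d *\<^sub>R x \<le> \<bar>d\<bar> *\<^sub>R modulus x" for d
  proof (cases "0 \<le> d")
    case True
    then show ?thesis
      by (simp add: modulus_def scaleR_left_mono)
  next
    case False
    then have "(- d) *\<^sub>R (- x) \<le> (- d) *\<^sub>R modulus x"
      by (intro scaleR_left_mono) (auto simp: modulus_def)
    with False show ?thesis
      by simp
  qed
  show ?thesis
    unfolding modulus_def[of "c *\<^sub>R x"] using *[of c] *[of "- c"] by simp
qed

text \<open>Subtracting a nonnegative element from the left side keeps it below \<open>w\<close>.
  Subtract \<open>v\<close> to get below \<open>inf u w\<close>, then subtract
  \<open>inf u w\<close> instead to get below \<open>inf v w\<close>. This is what makes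
  disjointness additive.\<close>

lemma inf_add_le:
  fixes u v w :: "'e::{ordered_real_vector,lattice}"
  assumes "0 \<le> u" "0 \<le> v" "0 \<le> w"
  shows "inf (u + v) w \<le> inf u w + inf v w"
proof -
  let ?t = "inf (u + v) w"
  have t: "?t \<le> u + v" "?t \<le> w"
    by auto
  have "?t - v \<le> u"
    using t(1) by (simp add: diff_le_eq)
  moreover have "?t - v \<le> w"
    using t(2) assms(2) by (metis diff_le_eq add_increasing2 order_trans)
  ultimately have "?t - v \<le> inf u w"
    by (rule le_infI)
  then have "?t - inf u w \<le> v"
    by (metis diff_le_eq add.commute)
  moreover have "0 \<le> inf u w"
    using assms by simp
  then have "?t - inf u w \<le> w"
    using t(2) by (metis diff_le_eq add_increasing2 order_trans)
  ultimately have "?t - inf u w \<le> inf v w"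
    by (rule le_infI)
  then show ?thesis
    by (metis diff_le_eq add.commute)
qed

lemma subspace_disjoint_complement:
  fixes E B :: "'e::{ordered_real_vector,lattice} set"
  assumes "vector_lattice E"
  shows "subspace (disjoint_complement E B)"
proof -
  have E: "subspace E"
    using assms by (simp add: vector_lattice_def)
  have disjI: "inf (modulus z) w = 0" if "inf (modulus z) w \<le> 0" "0 \<le> w" for z w :: 'e
    using that modulus_nonneg[of z] by (intro antisym) simp_all
  have "inf (modulus (x + y)) (modulus b) = 0"
    if "inf (modulus x) (modulus b) = 0" "inf (modulus y) (modulus b) = 0" for x y b :: 'e
  proof (rule disjI)
    have "inf (modulus (x + y)) (modulus b) \<le> inf (modulus x + modulus y) (modulus b)"
      by (intro inf_mono modulus_triangle order_refl)
    also have "\<dots> \<le> inf (modulus x) (modulus b) + inf (modulus y) (modulus b)"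
      by (intro inf_add_le modulus_nonneg)
    finally show "inf (modulus (x + y)) (modulus b) \<le> 0"
      using that by simp
  qed (rule modulus_nonneg)
  moreover have "inf (modulus (c *\<^sub>R x)) (modulus b) = 0"
    if "inf (modulus x) (modulus b) = 0" for c :: real and x b :: 'e
  proof (rule disjI)
    let ?t = "inf (modulus (c *\<^sub>R x)) (modulus b)"
    \<comment> \<open>With \<open>k\<close> at least both 1 and \<bar>c\<bar>, the single factor 1/k
      brings \<open>?t\<close> below \<open>modulus x\<close> and \<open>modulus b\<close> at once,
      hence below their meet 0. The 1 also keeps \<open>k\<close> invertible when
      \<open>c = 0\<close>.\<close>
    define k where "k = max 1 \<bar>c\<bar>"
    have k: "k > 0" "1 \<le> k" "\<bar>c\<bar> \<le> k"
      by (auto simp: k_def)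
    have *: "inverse k *\<^sub>R ?t \<le> z" if "?t \<le> k *\<^sub>R z" for z
      using scaleR_left_mono[OF that, of "inverse k"] k by simp
    have "?t \<le> \<bar>c\<bar> *\<^sub>R modulus x"
      by (rule order_trans[OF inf_le1 modulus_scaleR_le])
    also have "\<dots> \<le> k *\<^sub>R modulus x"
      by (intro scaleR_right_mono k modulus_nonneg)
    finally have 1: "inverse k *\<^sub>R ?t \<le> modulus x"
      by (rule *)
    have "?t \<le> 1 *\<^sub>R modulus b"
      by simp
    also have "\<dots> \<le> k *\<^sub>R modulus b"
      by (intro scaleR_right_mono k modulus_nonneg)
    finally have "inverse k *\<^sub>R ?t \<le> modulus b"
      by (rule *)
    with 1 have "inverse k *\<^sub>R ?t \<le> 0"
      using that by (metis inf_greatest)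
    then have "k *\<^sub>R (inverse k *\<^sub>R ?t) \<le> k *\<^sub>R 0"
      using k by (intro scaleR_left_mono) auto
    then show "?t \<le> 0"
      using k by simp
  qed (rule modulus_nonneg)
  moreover have "inf (modulus 0) (modulus b) = 0" for b :: 'e
    by (simp add: modulus_of_nonneg modulus_nonneg inf_absorb1)
  ultimately show ?thesis
    using E by (auto simp: subspace_def disjoint_complement_def)
qed

section \<open>Order ideals, bands and components\<close>

lemma order_ideal_of_nonneg_le:
  assumes "order_ideal E B" "x \<in> E" "y \<in> B" "0 \<le> x" "x \<le> y"
  shows "x \<in> B"
proof -
  have "modulus x = x" "modulus y = y"
    using assms(4,5) by (auto intro: modulus_of_nonneg)
  with assms show ?thesis
    unfolding order_ideal_def by metis
qed

lemma modulus_in_order_ideal: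
  assumes "vector_lattice E" "order_ideal E B" "b \<in> B"
  shows "modulus b \<in> B"
proof -
  have "b \<in> E" "- b \<in> E"
    using assms subspace_neg[of E b] by (auto simp: order_ideal_def vector_lattice_def)
  then have "modulus b \<in> E"
    using assms(1) by (auto simp: vector_lattice_def modulus_def)
  moreover have "modulus (modulus b) = modulus b"
    by (intro modulus_of_nonneg modulus_nonneg)
  ultimately show ?thesis
    using assms(2,3) modulus_nonneg[of b] unfolding order_ideal_def by (metis order_refl)
qed

lemma band_component_of_nonneg:
  fixes E B :: "'e::{ordered_real_vector,lattice} set"
  assumes E: "vector_lattice E" and "order_complete E" and B: "band E B"
    and x: "x \<in> E" "0 \<le> x"
  obtains s where "s \<in> B" "x - s \<in> disjoint_complement E B"
proof -
  have subE: "subspace E" and latE: "\<And>a b. \<lbrakk>a \<in> E; b \<in> E\<rbrakk> \<Longrightarrow> sup a b \<in> E \<and> inf a b \<in> E"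
    using E by (auto simp: vector_lattice_def)
  have ideal: "order_ideal E B"
    using B by (simp add: band_def)
  then have subB: "subspace B" and BE: "B \<subseteq> E"
    by (auto simp: order_ideal_def)
  define A where "A = {b \<in> B. 0 \<le> b \<and> b \<le> x}"
  have "0 \<in> A"
    using x subspace_0[OF subB] by (simp add: A_def)
  have "A \<subseteq> E"
    using BE by (auto simp: A_def)
  moreover have "\<exists>u\<in>E. \<forall>a\<in>A. a \<le> u"
    using x by (auto simp: A_def)
  ultimately obtain s where s: "is_supremum E A s"
    using \<open>order_complete E\<close> \<open>0 \<in> A\<close> unfolding order_complete_def by blast
  \<comment> \<open>For nonnegative elements \<open>sup a b\<close> lies below \<open>a + b\<close>,
    so the ideal property puts it in \<open>B\<close>. Thus \<open>A\<close> is directed upwards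
    and, indexed by itself, is a net in \<open>B\<close> increasing to \<open>s\<close>.\<close>
  have "sup a b \<in> A" if a: "a \<in> A" and b: "b \<in> A" for a b
  proof -
    have "sup a b \<le> a + b"
      using a b by (auto simp: A_def add_increasing add_increasing2)
    moreover have "0 \<le> sup a b"
      using a by (auto simp: A_def intro: le_supI1)
    moreover have "sup a b \<in> E"
      using a b \<open>A \<subseteq> E\<close> latE by blast
    moreover have "a + b \<in> B"
      using a b subspace_add[OF subB] by (simp add: A_def)
    ultimately have "sup a b \<in> B"
      using order_ideal_of_nonneg_le[OF ideal] by blast
    with \<open>0 \<le> sup a b\<close> show ?thesis
      using a b by (auto simp: A_def)
  qed
  then have "\<exists>c\<in>A. a \<le> c \<and> b \<le> c" if "a \<in> A" "b \<in> A" for a b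
    using that by (meson sup_ge1 sup_ge2)
  then have "net_increases_to E A {(a, b). a \<le> b} (\<lambda>a. a) s"
    using s \<open>0 \<in> A\<close> unfolding net_increases_to_def directed_by_def by auto
  then have "s \<in> B"
    using band_closed_under_nets[OF B] by (auto simp: A_def)
  have "s \<le> x"
    using s x by (auto simp: is_supremum_def A_def)
  then have xs: "0 \<le> x - s"
    by simp
  have "x - s \<in> E"
    using subE x \<open>s \<in> B\<close> BE by (auto intro: subspace_diff)
  moreover have "inf (modulus (x - s)) (modulus b) = 0" if "b \<in> B" for b
  proof -
    define w where "w = inf (x - s) (modulus b)"
    have mb: "modulus b \<in> B"
      using modulus_in_order_ideal[OF E ideal that] .
    have "0 \<le> w"
      using xs modulus_nonneg by (simp add: w_def)
    have "w \<in> B"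
      using order_ideal_of_nonneg_le[OF ideal _ mb \<open>0 \<le> w\<close>] latE \<open>x - s \<in> E\<close> mb BE
      by (auto simp: w_def)
    \<comment> \<open>Since \<open>a \<le> s\<close> and \<open>w \<le> x - s\<close>, the sum
      \<open>a + w\<close> stays below \<open>x\<close> and so belongs to \<open>A\<close>. Hence
      \<open>s - w\<close> is again an upper bound of \<open>A\<close>, and leastness of
      \<open>s\<close> applies to it.\<close>
    have "a \<le> s - w" if "a \<in> A" for a
    proof -
      have "a \<le> s"
        using s that by (auto simp: is_supremum_def)
      moreover have "w \<le> x - s"
        by (simp add: w_def)
      ultimately have "a + w \<le> s + (x - s)"
        by (rule add_mono)
      then have "a + w \<in> A"
        using that \<open>0 \<le> w\<close> \<open>w \<in> B\<close> subspace_add[OF subB] by (auto simp: A_def)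
      then have "a + w \<le> s"
        using s by (auto simp: is_supremum_def)
      then show ?thesis
        by (simp add: le_diff_eq)
    qed
    moreover have "s - w \<in> E"
      using subE \<open>s \<in> B\<close> \<open>w \<in> B\<close> BE by (auto intro: subspace_diff)
    ultimately have "s \<le> s - w"
      using s by (auto simp: is_supremum_def)
    then have "w \<le> 0"
      by (simp add: le_diff_eq)
    then show ?thesis
      using \<open>0 \<le> w\<close> modulus_of_nonneg[OF xs] by (simp add: w_def antisym)
  qed
  ultimately have "x - s \<in> disjoint_complement E B"
    by (simp add: disjoint_complement_def)
  with \<open>s \<in> B\<close> show ?thesis
    by (rule that)
qed

theorem order_complete_imp_projection_property:
  fixes E :: "'e::{ordered_real_vector,lattice} set"
  assumes E: "vector_lattice E" and "order_complete E"
  shows "projection_property E"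
  unfolding projection_property_def projection_band_def direct_sum_def
proof (intro allI impI conjI)
  fix B assume B: "band E B"
  show "band E B" by (rule B)
  let ?D = "disjoint_complement E B"
  have subE: "subspace E"
    using E by (auto simp: vector_lattice_def)
  show subB: "subspace B"
    using B by (simp add: band_def order_ideal_def)
  show subD: "subspace ?D"
    by (rule subspace_disjoint_complement[OF E])
  have BE: "B \<subseteq> E" and DE: "?D \<subseteq> E"
    using B by (auto simp: band_def order_ideal_def disjoint_complement_def)
  have "\<exists>u v. x = u + v \<and> u \<in> B \<and> v \<in> ?D" if "x \<in> E" for x
  proof -
    \<comment> \<open>Components exist so far only for nonnegative elements; \<open>p\<close> and
      \<open>q\<close> are the positive and negative parts of \<open>x\<close>, and the two
      decompositions are subtracted.\<close>
    define p q where "p = sup x 0" and "q = p - x"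
    have "p \<in> E"
      using that E subspace_0[OF subE] by (auto simp: vector_lattice_def p_def)
    then have "q \<in> E"
      using that subE by (simp add: q_def subspace_diff)
    have "0 \<le> p" "0 \<le> q"
      by (auto simp: p_def q_def)
    obtain s where s: "s \<in> B" "p - s \<in> ?D"
      using band_component_of_nonneg[OF assms B \<open>p \<in> E\<close> \<open>0 \<le> p\<close>] .
    obtain t where t: "t \<in> B" "q - t \<in> ?D"
      using band_component_of_nonneg[OF assms B \<open>q \<in> E\<close> \<open>0 \<le> q\<close>] .
    have "s - t \<in> B" "(p - s) - (q - t) \<in> ?D"
      using s t subB subD by (auto intro: subspace_diff)
    moreover have "x = (s - t) + ((p - s) - (q - t))"
      by (simp add: q_def)
    ultimately show ?thesis
      by blast
  qed
  then show "E = {u + v | u v. u \<in> B \<and> v \<in> ?D}"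
    using subE BE DE by (auto intro!: subspace_add)
  \<comment> \<open>Such an \<open>x\<close> is disjoint from itself, so its modulus is 0.\<close>
  have "x = 0" if "x \<in> B" "x \<in> ?D" for x
    using that by (auto simp: disjoint_complement_def modulus_eq_0_iff)
  then show "B \<inter> ?D = {0}"
    using subspace_0[OF subB] subspace_0[OF subD] by auto
qed

section \<open>Bounded continuous functions\<close>

lemma modulus_apply: "modulus f x = \<bar>f x :: real\<bar>"
  unfolding modulus_def sup_fun_def sup_max fun_Compl_def by linarith

lemma C_bI:
  assumes "continuous_map X euclideanreal f" "\<And>x. x \<in> topspace X \<Longrightarrow> \<bar>f x\<bar> \<le> M"
    "\<And>x. x \<notin> topspace X \<Longrightarrow> f x = 0"
  shows "f \<in> C_b X"
  using assms by (auto simp: C_b_def bounded_iff)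

lemma C_b_bump:
  assumes "completely_regular_space X" "openin X U" "x \<in> U"
  obtains g where "g \<in> C_b X" "\<And>y. 0 \<le> g y" "g x = 1" "\<And>y. y \<notin> U \<Longrightarrow> g y = 0"
proof -
  have U: "U \<subseteq> topspace X"
    using assms(2) by (rule openin_subset)
  have "closedin X (topspace X - U)" "x \<in> topspace X - (topspace X - U)"
    using assms U by auto
  then obtain f :: "'a \<Rightarrow> real" where f: "continuous_map X (top_of_set {0..1}) f" "f x = 0"
    and f1: "f ` (topspace X - U) \<subseteq> {1}"
    using assms(1) unfolding completely_regular_space_def by meson
  have range: "0 \<le> f y \<and> f y \<le> 1" if "y \<in> topspace X" for y
    using f(1) that by (auto simp: continuous_map_in_subtopology)
  \<comment> \<open>Complete regularity supplies \<open>f\<close> with value 0 at \<open>x\<close>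
    and 1 off \<open>U\<close>, and says nothing off \<open>topspace X\<close>; so \<open>f\<close>
    is flipped and cut off there.\<close>
  define g where "g y = (if y \<in> topspace X then 1 - f y else 0)" for y
  have "continuous_map X euclideanreal (\<lambda>y. 1 - f y)"
    using f(1) by (intro continuous_map_diff) (auto simp: continuous_map_in_subtopology)
  then have "continuous_map X euclideanreal g"
    by (rule continuous_map_eq) (simp add: g_def)
  then have "g \<in> C_b X"
    using range by (intro C_bI[of _ _ 1]) (auto simp: g_def)
  moreover have "0 \<le> g y" for y
    using range by (auto simp: g_def)
  moreover have "g x = 1"
    using f(2) U assms(3) by (auto simp: g_def)
  moreover have "g y = 0" if "y \<notin> U" for y
    using f1 that by (auto simp: g_def)
  ultimately show ?thesis
    by (rule that)
qed

text \<open>Suprema in \<open>C_b X\<close> need not be pointwise, so vanishing on \<open>V\<close>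
  has to be argued for the limit: were \<open>s\<close> positive at a point of the open set
  \<open>V\<close>, a bump supported in \<open>V\<close> could be cut from \<open>s\<close> to give
  a smaller upper bound.\<close>

lemma band_vanishing_on_open:
  assumes "completely_regular_space X" "openin X V"
  shows "band (C_b X) {f \<in> C_b X. \<forall>y\<in>V. f y = 0}" (is "band _ ?B")
proof -
  have sub: "subspace (C_b X)"
    using vector_lattice_C_b by (auto simp: vector_lattice_def)
  then have "subspace ?B"
    by (auto simp: subspace_def scaleR_fun_def)
  moreover have "f y = 0" if "modulus f \<le> modulus g" "g y = 0" for f g :: "'a \<Rightarrow> real" and y
    using le_funD[OF that(1), of y] that(2) by (simp add: modulus_apply)
  ultimately have ideal: "order_ideal (C_b X) ?B"
    by (auto simp: order_ideal_def)
  have "s \<in> ?B"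
    if "net_increases_to (C_b X) I r f s" and f: "\<forall>i\<in>I. f i \<in> ?B \<and> 0 \<le> f i"
    for I :: "('a \<Rightarrow> real) set" and r f s
  proof -
    have s: "is_supremum (C_b X) (f ` I) s" and "I \<noteq> {}"
      using that(1) by (auto simp: net_increases_to_def directed_by_def)
    then have sC: "s \<in> C_b X" and f_le: "\<And>i. i \<in> I \<Longrightarrow> f i \<le> s"
      by (auto simp: is_supremum_def)
    have "0 \<le> s"
      using \<open>I \<noteq> {}\<close> f f_le by (meson all_not_in_conv order_trans)
    have "s x = 0" if "x \<in> V" for x
    proof -
      obtain g where g: "g \<in> C_b X" "\<And>y. 0 \<le> g y" "g x = 1" "\<And>y. y \<notin> V \<Longrightarrow> g y = 0"
        using C_b_bump[OF assms \<open>x \<in> V\<close>] by blast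
      \<comment> \<open>This is the positive part of \<open>s - g\<close>. Off \<open>V\<close> it
        equals \<open>s\<close>; on \<open>V\<close> it is nonnegative, while every
        \<open>f i\<close> vanishes there. So it still bounds the net.\<close>
      define u where "u = s - inf s g"
      have "u \<in> C_b X"
        using sC g(1) vector_lattice_C_b[of X] subspace_diff[OF sub]
        by (auto simp: u_def vector_lattice_def)
      moreover have "f i \<le> u" if i: "i \<in> I" for i
      proof (rule le_funI)
        fix y
        have "f i y = 0" if "y \<in> V"
          using f i that by auto
        then show "f i y \<le> u y"
          using g(4)[of y] le_funD[OF f_le[OF i], of y] le_funD[OF \<open>0 \<le> s\<close>, of y]
          by (cases "y \<in> V") (auto simp: u_def inf_min)
      qed
      ultimately have "s \<le> u"
        using s by (auto simp: is_supremum_def)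
      then have "min (s x) (g x) \<le> 0"
        using le_funD[of s u x] by (simp add: u_def inf_min)
      then show ?thesis
        using g(3) le_funD[OF \<open>0 \<le> s\<close>, of x] by (auto simp: min_def split: if_splits)
    qed
    with sC show ?thesis
      by simp
  qed
  with ideal show ?thesis
    unfolding band_def by blast
qed

section \<open>From projections to clopen closures\<close>

lemma projection_property_imp_extremally_disconnected:
  assumes cr: "completely_regular_space X" and proj: "projection_property (C_b X)"
  shows "extremally_disconnected X"
  unfolding extremally_disconnected_def
proof (intro allI impI)
  fix U assume U: "openin X U"
  define V where "V = topspace X - X closure_of U"
  have V: "openin X V"
    by (simp add: V_def openin_diff)
  have UX: "U \<subseteq> topspace X"
    using U by (rule openin_subset)
  define B where "B = {f \<in> C_b X. \<forall>y\<in>V. f y = 0}"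
  have "direct_sum (C_b X) B (disjoint_complement (C_b X) B)"
    using proj band_vanishing_on_open[OF cr V]
    by (auto simp: projection_property_def projection_band_def B_def)
  moreover define e :: "'a \<Rightarrow> real" where "e y = (if y \<in> topspace X then 1 else 0)" for y
  have "continuous_map X euclideanreal (\<lambda>y. 1)"
    by simp
  then have "continuous_map X euclideanreal e"
    by (rule continuous_map_eq) (simp add: e_def)
  then have "e \<in> C_b X"
    by (intro C_bI[of _ _ 1]) (auto simp: e_def)
  ultimately obtain u v where e: "e = u + v" and u: "u \<in> B"
    and v: "v \<in> disjoint_complement (C_b X) B"
    unfolding direct_sum_def by blast
  have cont: "continuous_map X euclideanreal u"
    using u by (simp add: B_def C_b_def)
  \<comment> \<open>A bump at \<open>y\<close> supported in \<open>U\<close> vanishes on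
    \<open>V\<close> and so lies in \<open>B\<close>. Disjointness from it forces the complementary
    part \<open>v\<close> to vanish at \<open>y\<close>.\<close>
  have "u y = 1" if y: "y \<in> U" for y
  proof -
    obtain g where g: "g \<in> C_b X" "\<And>z. 0 \<le> g z" "g y = 1" "\<And>z. z \<notin> U \<Longrightarrow> g z = 0"
      using C_b_bump[OF cr U \<open>y \<in> U\<close>] by blast
    have "U \<inter> V = {}"
      using closure_of_subset[OF UX] by (auto simp: V_def)
    then have "g \<in> B"
      using g(1,4) by (auto simp: B_def)
    then have "inf (modulus v) (modulus g) y = 0"
      using v by (simp add: disjoint_complement_def)
    then have "v y = 0"
      using g(3) by (simp add: modulus_apply inf_min min_def split: if_splits)
    then show ?thesis
      using fun_cong[OF e, of y] y UX by (auto simp: e_def)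
  qed
  then have "U \<subseteq> {y \<in> topspace X. u y \<ge> 1}"
    using UX by auto
  moreover have "closedin X {y \<in> topspace X. u y \<ge> 1}"
    using cont by (simp add: continuous_map_upper_lower_semicontinuous_le)
  ultimately have "X closure_of U \<subseteq> {y \<in> topspace X. u y \<ge> 1}"
    by (rule closure_of_minimal)
  moreover have "u y = 0" if "y \<in> V" for y
    using u that by (simp add: B_def)
  \<comment> \<open>On the closure \<open>u\<close> is at least 1 and on the rest of the space it is
    0, so any threshold strictly between separates the two.\<close>
  ultimately have "X closure_of U = {y \<in> topspace X. u y > 1/2}"
    using closure_of_subset_topspace[of X U] by (force simp: V_def)
  moreover have "openin X {y \<in> topspace X. u y > 1/2}"
    using cont unfolding continuous_map_upper_lower_semicontinuous_lt by blast
  ultimately show "openin X (X closure_of U)"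
    by simp
qed

section \<open>Suprema from clopen level sets\<close>

lemma extremally_disconnected_imp_order_complete:
  assumes ed: "extremally_disconnected X"
  shows "order_complete (C_b X)"
  unfolding order_complete_def
proof (intro allI impI, elim conjE bexE)
  fix A u
  assume A: "A \<subseteq> C_b X" "A \<noteq> {}" and u: "u \<in> C_b X" "\<forall>a\<in>A. a \<le> u"
  define K where "K t = X closure_of {x \<in> topspace X. \<exists>a\<in>A. t < a x}" for t
  have "openin X (\<Union>a\<in>A. {x \<in> topspace X. t < a x})" for t
    using A(1) by (intro openin_Union)
      (auto simp: C_b_def continuous_map_upper_lower_semicontinuous_lt)
  moreover have "{x \<in> topspace X. \<exists>a\<in>A. t < a x} = (\<Union>a\<in>A. {x \<in> topspace X. t < a x})" for t
    by blast
  ultimately have opn: "openin X (K t)" for t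
    using ed by (simp add: extremally_disconnected_def K_def)
  have cls: "closedin X (K t)" for t
    by (simp add: K_def)
  have anti: "K t' \<subseteq> K t" if "t \<le> t'" for t t'
    unfolding K_def using that by (intro closure_of_mono) force
  have in_K: "x \<in> K t" if "x \<in> topspace X" "a \<in> A" "t < a x" for x a t
    using that closure_of_subset[of "{x \<in> topspace X. \<exists>a\<in>A. t < a x}" X]
    by (auto simp: K_def)
  \<comment> \<open>A continuous upper bound \<open>w\<close> is at least \<open>t\<close> where
    some member of \<open>A\<close> exceeds \<open>t\<close>, hence also on the closure. With
    \<open>w = u\<close> this bounds the levels at a point; for general \<open>w\<close> it gives
    leastness.\<close>
  have K_le: "t \<le> w x" if "w \<in> C_b X" "\<forall>a\<in>A. a \<le> w" "x \<in> K t" for w x t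
  proof -
    have "{x \<in> topspace X. \<exists>a\<in>A. t < a x} \<subseteq> {x \<in> topspace X. w x \<ge> t}"
      using that(2) by (fastforce simp: le_fun_def intro: less_imp_le less_le_trans)
    moreover have "closedin X {x \<in> topspace X. w x \<ge> t}"
      using that(1) by (simp add: C_b_def continuous_map_upper_lower_semicontinuous_le)
    ultimately have "K t \<subseteq> {x \<in> topspace X. w x \<ge> t}"
      unfolding K_def by (rule closure_of_minimal)
    with that(3) show ?thesis
      by blast
  qed
  obtain a0 where a0: "a0 \<in> A"
    using A(2) by blast
  obtain M N where M: "\<And>x. x \<in> topspace X \<Longrightarrow> \<bar>a0 x\<bar> \<le> M"
    and N: "\<And>x. x \<in> topspace X \<Longrightarrow> \<bar>u x\<bar> \<le> N"
  proof -
    have "a0 \<in> C_b X"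
      using a0 A(1) by blast
    with u(1) show ?thesis
      using that by (force simp: C_b_def bounded_iff)
  qed
  define s where "s x = (if x \<in> topspace X then Sup {t. x \<in> K t} else 0)" for x
  \<comment> \<open>The real \<open>Sup\<close> is meaningful only for nonempty sets bounded above:
    \<open>a0\<close> provides a level, and \<open>u\<close> bounds all of them.\<close>
  have ne: "{t. x \<in> K t} \<noteq> {}" if "x \<in> topspace X" for x
    using in_K[OF that a0, of "a0 x - 1"] by auto
  have bdd: "bdd_above {t. x \<in> K t}" for x
    using K_le[OF u] by (meson bdd_above.I mem_Collect_eq)
  have less_s: "c < s x \<longleftrightarrow> (\<exists>t>c. x \<in> K t)" if "x \<in> topspace X" for c x
    using less_cSup_iff[OF ne[OF that] bdd] that by (auto simp: s_def)
  \<comment> \<open>Strict and weak comparison with \<open>s\<close> are both expressed through the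
    sets \<open>K t\<close>: the first yields a union of open \<open>K t\<close>, the negation of
    the second a union of complements of closed \<open>K t\<close>. Continuity of \<open>s\<close>
    thus uses that each \<open>K t\<close> is clopen.\<close>
  have le_s: "c \<le> s x \<longleftrightarrow> (\<forall>t<c. x \<in> K t)" if x: "x \<in> topspace X" for c x
  proof
    assume "c \<le> s x"
    show "\<forall>t<c. x \<in> K t"
    proof (intro allI impI)
      fix t assume "t < c"
      then have "t < s x"
        using \<open>c \<le> s x\<close> by simp
      then show "x \<in> K t"
        using less_s[OF x] anti by (meson less_imp_le subsetD)
    qed
  next
    assume *: "\<forall>t<c. x \<in> K t"
    show "c \<le> s x"
    proof (rule dense_le)
      fix t assume "t < c"
      with * show "t \<le> s x"
        using cSup_upper[OF _ bdd] x by (auto simp: s_def)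
    qed
  qed
  have "openin X {x \<in> topspace X. c < s x}" for c
  proof -
    have "{x \<in> topspace X. c < s x} = (\<Union>t\<in>{c<..}. K t)"
      using less_s openin_subset[OF opn] by blast
    then show ?thesis
      using opn by auto
  qed
  moreover have "openin X {x \<in> topspace X. s x < c}" for c
  proof -
    have "{x \<in> topspace X. s x < c} = (\<Union>t\<in>{..<c}. topspace X - K t)"
      using le_s[of _ c] by (auto simp: not_le[symmetric])
    moreover have "openin X (\<Union>t\<in>{..<c}. topspace X - K t)"
      using cls by (intro openin_Union) auto
    ultimately show ?thesis
      by simp
  qed
  ultimately have "continuous_map X euclideanreal s"
    by (simp add: continuous_map_upper_lower_semicontinuous_lt)
  moreover have upper: "a x \<le> s x" if "a \<in> A" "x \<in> topspace X" for a x
    using in_K[OF that(2,1)] le_s[OF that(2)] by blast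
  moreover have least: "s x \<le> w x" if "w \<in> C_b X" "\<forall>a\<in>A. a \<le> w" "x \<in> topspace X" for w x
    using cSup_least[OF ne] K_le[OF that(1,2)] that(3) by (auto simp: s_def)
  \<comment> \<open>On the space \<open>s\<close> lies between the bounded functions
    \<open>a0\<close> and \<open>u\<close>.\<close>
  have "\<bar>s x\<bar> \<le> max M N" if "x \<in> topspace X" for x
    using upper[OF a0 that] least[OF u that] M[OF that] N[OF that] by linarith
  ultimately have "s \<in> C_b X"
    by (intro C_bI[of _ _ "max M N"]) (auto simp: s_def)
  \<comment> \<open>The order is that of total functions; off \<open>topspace X\<close> both sides
    are 0.\<close>
  have "a \<le> s" if "a \<in> A" for a
    using upper[OF that] A(1) that by (force simp: le_fun_def C_b_def s_def)
  moreover have "s \<le> w" if "w \<in> C_b X" "\<forall>a\<in>A. a \<le> w" for w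
    using least[OF that] that(1) by (force simp: le_fun_def C_b_def s_def)
  ultimately show "\<exists>s. is_supremum (C_b X) A s"
    using \<open>s \<in> C_b X\<close> unfolding is_supremum_def by blast
qed

theorem theorem6p7:
  fixes X :: "'a topology"
  assumes "completely_regular_space X" and "Hausdorff_space X"
  shows "(order_complete (C_b X) \<longleftrightarrow> projection_property (C_b X)) \<and>
         (projection_property (C_b X) \<longleftrightarrow> extremally_disconnected X)"
  using order_complete_imp_projection_property[OF vector_lattice_C_b[of X]]
    projection_property_imp_extremally_disconnected[OF assms(1)]
    extremally_disconnected_imp_order_complete[of X]
  by blast

end
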